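(* Let $\alpha,\beta>0$ with $\alpha+\beta<\pi$ and put $c=\sin\alpha\sin\beta$. Let $v$ be the infimum of $\ell(\boldsymbol\gamma)$ over all continuous rectifiable paths $\boldsymbol\gamma:[0,1]\to\mathbb R^2$ with $\boldsymbol\gamma(0)=\mathbf 0$ and $F_{\boldsymbol\gamma}(t)\ge c$ for all $t\in[0,2\pi)$. For integers $K,M\ge1$, let $v_K$ be the optimal value (infimum) of the length $\sum_{i=1}^K\|\mathbf q_i-\mathbf q_{i-1}\|$ over all polygonal paths $\mathbf 0=\mathbf q_0\to\mathbf q_1\to\cdots\to\mathbf q_K$ in $\mathbb R^2$ satisfying $F(t)\ge c$ for all $t\in[0,2\pi)$, and let $v_{K,M}$ be the optimal value of the same problem in which the constraint $F(t)\ge c$ is imposed only at $t=t_j=\frac{2\pi j}{M}$, $j=0,\dots,M-1$. Then for each fixed $K$, $$v_{K,M}\to v_K\qquad\text{as }M\to\infty .$$ Furthermore, if $K_n\to\infty$ and $M_n\to\infty$, then $$v_{K_n,M_n}\to v\qquad\text{as }n\to\infty.$$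
   Context: $\ell$ denotes the length (total variation) of a path. For a continuous path $\boldsymbol\gamma:[0,1]\to\mathbb R^2$ with $\boldsymbol\gamma(0)=\mathbf 0$, its support function is $h_{\boldsymbol\gamma}(\phi)=\max_{p\in[0,1]}\boldsymbol\gamma(p)\cdot(\cos\phi,\sin\phi)$, and $$F_{\boldsymbol\gamma}(t)=\sin\beta\,h_{\boldsymbol\gamma}(t+\pi+\alpha)+\sin\alpha\,h_{\boldsymbol\gamma}(t+\pi-\beta)+\sin(\alpha+\beta)\,h_{\boldsymbol\gamma}(t).$$ For a polygonal path with vertices $\mathbf q_0=\mathbf 0,\mathbf q_1,\dots,\mathbf q_K$, the support function is $h_K(\phi)=\max_{0\le i\le K}\mathbf q_i\cdot(\cos\phi,\sin\phi)$, which agrees with the support function of the path as a continuous path, and $F$ is defined from it by the same formula. *)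

theory Defs
  imports "HOL-Analysis.Analysis"
begin

text \<open>All optimal values are infima in the extended reals, so that the infimum over an empty
  feasible set would be \<open>\<infinity>\<close>, and the length of a non-rectifiable path is \<open>\<infinity>\<close>.\<close>

definition path_length :: "(real \<Rightarrow> 'a::metric_space) \<Rightarrow> ereal" where
  "path_length \<gamma> =
     (SUP xs \<in> {xs. sorted xs \<and> set xs \<subseteq> {0..1}}.
        ereal (\<Sum>i<length xs - 1. dist (\<gamma> (xs ! i)) (\<gamma> (xs ! Suc i))))"

definition direction :: "real \<Rightarrow> real ^ 2" where
  "direction \<phi> = vector [cos \<phi>, sin \<phi>]"

text \<open>For a continuous path the supremum below is attained, i.e. it is a maximum.\<close>

definition path_support :: "(real \<Rightarrow> real ^ 2) \<Rightarrow> real \<Rightarrow> real" where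
  "path_support \<gamma> \<phi> = (SUP p\<in>{0..1}. \<gamma> p \<bullet> direction \<phi>)"

text \<open>A polygonal path with \<open>K\<close> edges is given by its vertices \<open>q 0, \<dots>, q K\<close>; the values of \<open>q\<close>
  beyond \<open>K\<close> are irrelevant.\<close>

definition polygon_support :: "nat \<Rightarrow> (nat \<Rightarrow> real ^ 2) \<Rightarrow> real \<Rightarrow> real" where
  "polygon_support K q \<phi> = Max ((\<lambda>i. q i \<bullet> direction \<phi>) ` {0..K})"

definition polygon_length :: "nat \<Rightarrow> (nat \<Rightarrow> real ^ 2) \<Rightarrow> real" where
  "polygon_length K q = (\<Sum>i=1..K. norm (q i - q (i - 1)))"

text \<open>The argument \<open>h\<close> is the support function of a path.\<close>

definition F :: "real \<Rightarrow> real \<Rightarrow> (real \<Rightarrow> real) \<Rightarrow> real \<Rightarrow> real" where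
  "F \<alpha> \<beta> h t =
     sin \<beta> * h (t + pi + \<alpha>) + sin \<alpha> * h (t + pi - \<beta>) + sin (\<alpha> + \<beta>) * h t"

definition feasible_paths :: "real \<Rightarrow> real \<Rightarrow> (real \<Rightarrow> real ^ 2) set" where
  "feasible_paths \<alpha> \<beta> =
     {\<gamma>. path \<gamma> \<and> path_length \<gamma> < \<infinity> \<and> \<gamma> 0 = 0 \<and>
         (\<forall>t\<in>{0..<2 * pi}. F \<alpha> \<beta> (path_support \<gamma>) t \<ge> sin \<alpha> * sin \<beta>)}"

definition feasible_polygons :: "real \<Rightarrow> real \<Rightarrow> nat \<Rightarrow> real set \<Rightarrow> (nat \<Rightarrow> real ^ 2) set" where
  "feasible_polygons \<alpha> \<beta> K T =
     {q. q 0 = 0 \<and> (\<forall>t\<in>T. F \<alpha> \<beta> (polygon_support K q) t \<ge> sin \<alpha> * sin \<beta>)}"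

definition opt_path :: "real \<Rightarrow> real \<Rightarrow> ereal" where
  "opt_path \<alpha> \<beta> = (INF \<gamma> \<in> feasible_paths \<alpha> \<beta>. path_length \<gamma>)"

definition opt_polygon :: "real \<Rightarrow> real \<Rightarrow> nat \<Rightarrow> ereal" where
  "opt_polygon \<alpha> \<beta> K =
     (INF q \<in> feasible_polygons \<alpha> \<beta> K {0..<2 * pi}. ereal (polygon_length K q))"

definition opt_polygon_discrete :: "real \<Rightarrow> real \<Rightarrow> nat \<Rightarrow> nat \<Rightarrow> ereal" where
  "opt_polygon_discrete \<alpha> \<beta> K M =
     (INF q \<in> feasible_polygons \<alpha> \<beta> K ((\<lambda>j. 2 * pi * real j / real M) ` {..<M}).
        ereal (polygon_length K q))"

end

theory Submission
  imports Defs
begin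

text \<open>The functional \<open>F\<close> is monotone and positively homogeneous in the support function, so a
  path that violates the constraint by a small relative amount \<open>\<delta>\<close> becomes feasible after scaling
  by \<open>1 / (1 - \<delta>)\<close>, at the cost of the same factor in length. A polygonal path of length at most
  \<open>R\<close> has a Lipschitz support function with constant \<open>O(R)\<close>, so imposing the constraint only on
  a mesh of width \<open>2 \<pi> / M\<close> loses \<open>\<delta> = O(R / M)\<close>, and \<open>R\<close> can be taken to be the length of a
  fixed feasible segment, independently of \<open>K\<close>. Likewise the polygon inscribed in a rectifiable path
  at the parameters \<open>i / K\<close> loses an amount controlled by the modulus of continuity of the path.
  No compactness of the set of admissible polygons is needed.\<close>

section \<open>Unit directions and support functions of polygons\<close>

lemma norm_direction [simp]: "norm (direction \<phi>) = 1"
  by (simp add: direction_def norm_eq_sqrt_inner inner_vec_def UNIV_2 flip: power2_eq_square)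

text \<open>Both coordinates are 1-Lipschitz, and the norm is at most the sum of their absolute
  values; hence the factor 2, which is not sharp.\<close>

lemma direction_lipschitz: "norm (direction \<phi> - direction \<psi>) \<le> 2 * \<bar>\<phi> - \<psi>\<bar>"
proof -
  have s: "\<bar>sin \<phi> - sin \<psi>\<bar> \<le> \<bar>\<phi> - \<psi>\<bar>" for \<phi> \<psi> :: real
  proof -
    have "\<bar>sin \<phi> - sin \<psi>\<bar> = 2 * \<bar>sin ((\<phi> - \<psi>) / 2)\<bar> * \<bar>cos ((\<phi> + \<psi>) / 2)\<bar>"
      by (simp add: sin_diff_sin abs_mult)
    also have "\<dots> \<le> 2 * \<bar>(\<phi> - \<psi>) / 2\<bar> * 1"
      by (intro mult_mono abs_sin_x_le_abs_x) (auto simp: abs_sin_x_le_abs_x)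
    finally show ?thesis by simp
  qed
  have c: "\<bar>cos \<phi> - cos \<psi>\<bar> \<le> \<bar>\<phi> - \<psi>\<bar>"
    using s[of "\<phi> + pi/2" "\<psi> + pi/2"] by (simp add: sin_add)
  have "norm (direction \<phi> - direction \<psi>) \<le> \<bar>cos \<phi> - cos \<psi>\<bar> + \<bar>sin \<phi> - sin \<psi>\<bar>"
    using norm_le_l1_cart[of "direction \<phi> - direction \<psi>"]
    by (simp add: direction_def sum_2)
  also have "\<dots> \<le> \<bar>\<phi> - \<psi>\<bar> + \<bar>\<phi> - \<psi>\<bar>" by (rule add_mono[OF c s])
  finally show ?thesis by simp
qed

lemma inner_direction_le: "x \<bullet> direction \<phi> \<le> norm x"
  using norm_cauchy_schwarz[of x "direction \<phi>"] by simp

lemma polygon_support_leI: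
  assumes "\<And>i. i \<le> K \<Longrightarrow> q i \<bullet> direction \<phi> \<le> b"
  shows "polygon_support K q \<phi> \<le> b"
  using assms by (auto simp: polygon_support_def)

lemma polygon_support_geI:
  assumes "i \<le> K"
  shows "q i \<bullet> direction \<phi> \<le> polygon_support K q \<phi>"
  using assms by (auto simp: polygon_support_def)

lemma polygon_support_scaleR:
  assumes "r \<ge> 0"
  shows "polygon_support K (\<lambda>i. r *\<^sub>R q i) \<phi> = r * polygon_support K q \<phi>"
proof -
  have "mono (\<lambda>x. r * x)" using assms by (simp add: mono_def mult_left_mono)
  then show ?thesis
    by (simp add: polygon_support_def mono_Max_commute image_image)
qed

lemma polygon_length_scaleR:
  "polygon_length K (\<lambda>i. r *\<^sub>R q i) = \<bar>r\<bar> * polygon_length K q"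
  by (simp add: polygon_length_def sum_distrib_left flip: scaleR_diff_right)

lemma polygon_length_nonneg [simp]: "polygon_length K q \<ge> 0"
  by (simp add: polygon_length_def sum_nonneg)

text \<open>This turns a bound on the length into the radius that
  \<open>polygon_support_lipschitz\<close> needs, whatever the number of edges.\<close>

lemma norm_vertex_le_polygon_length:
  assumes "q 0 = 0" "i \<le> K"
  shows "norm (q i) \<le> polygon_length K q"
proof -
  have "norm (q i) \<le> polygon_length i q"
  proof (induction i)
    case (Suc i)
    have "norm (q (Suc i)) \<le> norm (q i) + norm (q (Suc i) - q i)"
      by (metis norm_triangle_sub)
    then show ?case using Suc by (simp add: polygon_length_def)
  qed (simp add: assms polygon_length_def)
  also have "\<dots> \<le> polygon_length K q"
    unfolding polygon_length_def using assms by (intro sum_mono2) auto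
  finally show ?thesis .
qed

text \<open>By Cauchy-Schwarz each vertex gives a Lipschitz function of the angle with the same
  constant, and a maximum inherits it. Exchanging the two angles gives the other half of the
  estimate.\<close>

lemma polygon_support_lipschitz:
  assumes "\<And>i. i \<le> K \<Longrightarrow> norm (q i) \<le> R"
  shows "polygon_support K q \<phi> \<le> polygon_support K q \<psi> + 2 * R * \<bar>\<phi> - \<psi>\<bar>"
proof (rule polygon_support_leI)
  fix i assume i: "i \<le> K"
  have R: "0 \<le> R" using assms[OF i] norm_ge_zero order_trans by blast
  have "q i \<bullet> direction \<phi> = q i \<bullet> direction \<psi> + q i \<bullet> (direction \<phi> - direction \<psi>)"
    by (simp add: inner_diff_right)
  also have "q i \<bullet> (direction \<phi> - direction \<psi>) \<le> norm (q i) * norm (direction \<phi> - direction \<psi>)"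
    by (rule norm_cauchy_schwarz)
  also have "\<dots> \<le> R * (2 * \<bar>\<phi> - \<psi>\<bar>)"
    using assms[OF i] direction_lipschitz R by (intro mult_mono) auto
  finally show "q i \<bullet> direction \<phi> \<le> polygon_support K q \<psi> + 2 * R * \<bar>\<phi> - \<psi>\<bar>"
    using polygon_support_geI[OF i, of q \<psi>] by linarith
qed

section \<open>Rescaling and first comparisons of optimal values\<close>

lemma F_scale: "F \<alpha> \<beta> (\<lambda>\<phi>. r * h \<phi>) t = r * F \<alpha> \<beta> h t"
  by (simp add: F_def algebra_simps)

lemma opt_polygon_nonneg: "0 \<le> opt_polygon \<alpha> \<beta> K"
  unfolding opt_polygon_def by (intro INF_greatest) simp

lemma path_length_nonneg: "0 \<le> path_length \<gamma>"
  unfolding path_length_def by (rule SUP_upper2[of "[]"]) auto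

text \<open>All sample angles lie in \<open>{0..<2 * pi}\<close>, so sampling only enlarges the
  feasible set.\<close>

lemma opt_polygon_discrete_le_opt_polygon: "opt_polygon_discrete \<alpha> \<beta> K M \<le> opt_polygon \<alpha> \<beta> K"
  unfolding opt_polygon_discrete_def opt_polygon_def
  by (rule INF_superset_mono) (auto simp: feasible_polygons_def field_simps)

text \<open>Scaling about the origin keeps the starting point and multiplies both \<open>F\<close>
  and the length. This repairs three kinds of deficit: that of a unit segment, of an inscribed
  polygon, and of a constraint sampled at finitely many angles.\<close>

lemma opt_polygon_le_rescaled:
  assumes "q 0 = 0" "\<delta> < 1"
    and "\<And>t. t \<in> {0..<2 * pi} \<Longrightarrow>
      F \<alpha> \<beta> (polygon_support K q) t \<ge> (1 - \<delta>) * (sin \<alpha> * sin \<beta>)"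
  shows "opt_polygon \<alpha> \<beta> K \<le> ereal (polygon_length K q / (1 - \<delta>))"
proof -
  define r where "r = 1 / (1 - \<delta>)"
  have r: "r > 0" "r * (1 - \<delta>) = 1" using assms by (auto simp: r_def)
  have "sin \<alpha> * sin \<beta> \<le> r * F \<alpha> \<beta> (polygon_support K q) t" if "t \<in> {0..<2 * pi}" for t
  proof -
    have "sin \<alpha> * sin \<beta> = r * ((1 - \<delta>) * (sin \<alpha> * sin \<beta>))"
      using r(2) by (simp flip: mult.assoc)
    also have "\<dots> \<le> r * F \<alpha> \<beta> (polygon_support K q) t"
      using assms(3)[OF that] r by (intro mult_left_mono) auto
    finally show ?thesis .
  qed
  moreover have "polygon_support K (\<lambda>i. r *\<^sub>R q i) = (\<lambda>\<phi>. r * polygon_support K q \<phi>)"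
    using r by (auto simp: polygon_support_scaleR)
  ultimately have "(\<lambda>i. r *\<^sub>R q i) \<in> feasible_polygons \<alpha> \<beta> K {0..<2 * pi}"
    using assms(1) by (auto simp: feasible_polygons_def F_scale)
  then have "opt_polygon \<alpha> \<beta> K \<le> ereal (polygon_length K (\<lambda>i. r *\<^sub>R q i))"
    unfolding opt_polygon_def by (rule INF_lower)
  then show ?thesis using r by (simp add: polygon_length_scaleR r_def)
qed

section \<open>Polygons as continuous paths\<close>

text \<open>Edge \<open>i + 1\<close> is traversed at constant speed while \<open>p\<close> runs through \<open>[i / K, (i + 1) / K]\<close>.\<close>

definition polygon_path :: "nat \<Rightarrow> (nat \<Rightarrow> 'a::real_normed_vector) \<Rightarrow> real \<Rightarrow> 'a" where
  "polygon_path K q p = q 0 + (\<Sum>i<K. max 0 (min 1 (K * p - i)) *\<^sub>R (q (Suc i) - q i))"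

lemma path_polygon_path: "path (polygon_path K q)"
  unfolding path_def polygon_path_def by (intro continuous_intros)

lemma polygon_path_vertex:
  assumes "j \<le> K" "K > 0"
  shows "polygon_path K q (j / K) = q j"
proof -
  \<comment> \<open>The clamped weight of edge \<open>i\<close> at \<open>j / K\<close> is that of
    the integer \<open>j - i\<close>: 1 if \<open>i < j\<close>, else 0.\<close>
  have "(\<Sum>i<K. max 0 (min 1 (K * (real j / K) - i)) *\<^sub>R (q (Suc i) - q i))
      = (\<Sum>i<K. if i < j then q (Suc i) - q i else 0)"
    using assms by (intro sum.cong) (auto simp: max_def min_def)
  also have "\<dots> = (\<Sum>i<j. q (Suc i) - q i)"
    using assms by (intro sum.mono_neutral_cong_right) auto
  finally show ?thesis by (simp add: polygon_path_def sum_lessThan_telescope)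
qed

text \<open>Each edge weight is nondecreasing in the parameter with values between 0 and 1, so its
  increments over any partition add up to at most 1.\<close>

lemma path_length_polygon_path: "path_length (polygon_path K q) \<le> ereal (polygon_length K q)"
  unfolding path_length_def
proof (rule SUP_least)
  fix xs :: "real list" assume "xs \<in> {xs. sorted xs \<and> set xs \<subseteq> {0..1}}"
  then have xs: "sorted xs" by auto
  define w where "w i p = max 0 (min 1 (K * p - real i))" for i :: nat and p :: real
  \<comment> \<open>For the empty list truncated subtraction gives \<open>n = 0\<close>: the sums
    over \<open>k\<close> are empty and the telescoped difference is zero.\<close>
  define n where "n = length xs - 1"
  have edge: "dist (polygon_path K q (xs ! k)) (polygon_path K q (xs ! Suc k))
      \<le> (\<Sum>i<K. (w i (xs ! Suc k) - w i (xs ! k)) * norm (q (Suc i) - q i))" if "k < n" for k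
  proof -
    have le: "xs ! k \<le> xs ! Suc k" using xs that by (simp add: n_def sorted_nth_mono)
    have mono: "w i (xs ! k) \<le> w i (xs ! Suc k)" for i
      using mult_left_mono[OF le, of "real K"] by (auto simp: w_def)
    have "dist (polygon_path K q (xs ! k)) (polygon_path K q (xs ! Suc k))
        = dist (polygon_path K q (xs ! Suc k)) (polygon_path K q (xs ! k))"
      by (rule dist_commute)
    also have "\<dots> = norm (\<Sum>i<K. (w i (xs ! Suc k) - w i (xs ! k)) *\<^sub>R (q (Suc i) - q i))"
      by (simp add: polygon_path_def w_def dist_norm
          flip: sum_subtractf scaleR_diff_left)
    also have "\<dots> \<le> (\<Sum>i<K. norm ((w i (xs ! Suc k) - w i (xs ! k)) *\<^sub>R (q (Suc i) - q i)))"
      by (rule norm_sum)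
    also have "\<dots> = (\<Sum>i<K. (w i (xs ! Suc k) - w i (xs ! k)) * norm (q (Suc i) - q i))"
      using mono by simp
    finally show ?thesis .
  qed
  have "(\<Sum>k<n. dist (polygon_path K q (xs ! k)) (polygon_path K q (xs ! Suc k)))
      \<le> (\<Sum>k<n. \<Sum>i<K. (w i (xs ! Suc k) - w i (xs ! k)) * norm (q (Suc i) - q i))"
    using edge by (intro sum_mono) auto
  also have "\<dots> = (\<Sum>i<K. \<Sum>k<n. (w i (xs ! Suc k) - w i (xs ! k)) * norm (q (Suc i) - q i))"
    by (rule sum.swap)
  also have "\<dots> = (\<Sum>i<K. (w i (xs ! n) - w i (xs ! 0)) * norm (q (Suc i) - q i))"
    using sum_lessThan_telescope[of "\<lambda>k. w i (xs ! k)" n for i]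
    by (simp flip: sum_distrib_right)
  also have "\<dots> \<le> (\<Sum>i<K. 1 * norm (q (Suc i) - q i))"
    by (intro sum_mono mult_right_mono) (auto simp: w_def)
  also have "\<dots> = polygon_length K q"
    by (simp add: polygon_length_def sum.atLeast1_atMost_eq)
  finally show "ereal (\<Sum>i<length xs - 1. dist (polygon_path K q (xs ! i))
      (polygon_path K q (xs ! Suc i))) \<le> ereal (polygon_length K q)"
    by (simp add: n_def)
qed

lemma bdd_above_path_support:
  assumes "path \<gamma>"
  shows "bdd_above ((\<lambda>p. \<gamma> p \<bullet> direction \<phi>) ` {0..1})"
proof -
  have "compact ((\<lambda>p. \<gamma> p \<bullet> direction \<phi>) ` {0..1})"
    using assms unfolding path_def by (intro compact_continuous_image continuous_intros) auto
  then show ?thesis by (intro bounded_imp_bdd_above compact_imp_bounded)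
qed

text \<open>Every vertex lies on the path. As \<open>F\<close> is monotone in the support function,
  this direction carries feasibility from the polygon to the path.\<close>

lemma polygon_support_le_path_support:
  assumes "K > 0"
  shows "polygon_support K q \<phi> \<le> path_support (polygon_path K q) \<phi>"
proof (rule polygon_support_leI)
  fix i assume i: "i \<le> K"
  have "polygon_path K q (i / K) \<bullet> direction \<phi> \<le> path_support (polygon_path K q) \<phi>"
    unfolding path_support_def using i assms
    by (intro cSUP_upper bdd_above_path_support path_polygon_path) auto
  then show "q i \<bullet> direction \<phi> \<le> path_support (polygon_path K q) \<phi>"
    using i assms by (simp add: polygon_path_vertex)
qed

section \<open>Inscribed polygons and padding of polygons\<close>

definition sampled_polygon :: "nat \<Rightarrow> (real \<Rightarrow> 'a) \<Rightarrow> nat \<Rightarrow> 'a" where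
  "sampled_polygon K \<gamma> i = \<gamma> (i / K)"

text \<open>The uniform partition into \<open>K\<close> intervals is a competitor in the supremum
  defining \<open>path_length\<close>.\<close>

lemma polygon_length_sampled:
  assumes "K > 0"
  shows "ereal (polygon_length K (sampled_polygon K \<gamma>)) \<le> path_length \<gamma>"
proof -
  define xs where "xs = map (\<lambda>i. real i / K) [0..<Suc K]"
  have nth: "xs ! i = real i / K" if "i \<le> K" for i
    using that unfolding xs_def by (subst nth_map) (auto simp del: upt_Suc)
  have "sorted xs"
    by (auto simp: xs_def sorted_iff_nth_mono divide_right_mono simp del: upt_Suc)
  moreover have "set xs \<subseteq> {0..1}" using assms by (auto simp: xs_def field_simps)
  ultimately have "ereal (\<Sum>i<length xs - 1. dist (\<gamma> (xs ! i)) (\<gamma> (xs ! Suc i))) \<le> path_length \<gamma>"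
    unfolding path_length_def by (intro SUP_upper) auto
  also have "(\<Sum>i<length xs - 1. dist (\<gamma> (xs ! i)) (\<gamma> (xs ! Suc i)))
      = (\<Sum>i<K. dist (\<gamma> (i / K)) (\<gamma> (Suc i / K)))"
    by (intro sum.cong) (auto simp: nth, simp add: xs_def)
  also have "\<dots> = polygon_length K (sampled_polygon K \<gamma>)"
    by (simp add: polygon_length_def sampled_polygon_def sum.atLeast1_atMost_eq dist_norm
        norm_minus_commute)
  finally show ?thesis .
qed

lemma path_support_le_sampled:
  assumes "K > 0"
    and mod: "\<And>p p'. p \<in> {0..1} \<Longrightarrow> p' \<in> {0..1} \<Longrightarrow> \<bar>p - p'\<bar> \<le> 1 / K \<Longrightarrow> dist (\<gamma> p) (\<gamma> p') \<le> \<epsilon>"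
  shows "path_support \<gamma> \<phi> \<le> polygon_support K (sampled_polygon K \<gamma>) \<phi> + \<epsilon>"
  unfolding path_support_def
proof (rule cSUP_least)
  fix p :: real assume p: "p \<in> {0..1}"
  \<comment> \<open>The last sample parameter at or before \<open>p\<close>; for
    \<open>p = 1\<close> it is the endpoint \<open>i = K\<close>.\<close>
  define i where "i = nat \<lfloor>K * p\<rfloor>"
  have "0 \<le> K * p" "K * p \<le> K" using p by (auto simp: mult_left_le)
  then have i: "i \<le> K" "real i \<le> K * p" "K * p \<le> i + 1"
    unfolding i_def by linarith+
  have "p - i / K = (K * p - i) / K" using assms(1) by (simp add: field_simps)
  also have "\<bar>\<dots>\<bar> \<le> 1 / K"
    using i unfolding abs_divide abs_of_nat by (intro divide_right_mono) auto
  finally have "\<bar>p - i / K\<bar> \<le> 1 / K" .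
  moreover have "i / K \<in> {0..1}"
    using i assms(1) by (auto simp: field_simps)
  ultimately have "norm (\<gamma> p - \<gamma> (i / K)) \<le> \<epsilon>"
    using mod[OF p, of "i / K"] by (simp add: dist_norm)
  then have "(\<gamma> p - \<gamma> (i / K)) \<bullet> direction \<phi> \<le> \<epsilon>"
    using inner_direction_le order_trans by blast
  then show "\<gamma> p \<bullet> direction \<phi> \<le> polygon_support K (sampled_polygon K \<gamma>) \<phi> + \<epsilon>"
    using polygon_support_geI[OF i(1), of "sampled_polygon K \<gamma>" \<phi>]
    by (simp add: sampled_polygon_def inner_diff_left)
qed auto

text \<open>Repeating the last vertex adds only edges of length zero and leaves the set of vertices
  unchanged.\<close>

lemma opt_polygon_antimono:
  assumes "K \<le> K'"
  shows "opt_polygon \<alpha> \<beta> K' \<le> opt_polygon \<alpha> \<beta> K"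
  unfolding opt_polygon_def
proof (rule INF_mono)
  fix q assume q: "q \<in> feasible_polygons \<alpha> \<beta> K {0..<2 * pi}"
  define q' where "q' i = q (min i K)" for i
  have "(\<lambda>i. q' i \<bullet> direction \<phi>) ` {0..K'} = (\<lambda>i. q i \<bullet> direction \<phi>) ` {0..K}" for \<phi>
    using assms by (force simp: q'_def image_iff min_def)
  then have "polygon_support K' q' = polygon_support K q"
    by (auto simp: polygon_support_def)
  moreover have "polygon_length K' q' = polygon_length K q"
    unfolding polygon_length_def using assms
    by (intro sum.mono_neutral_cong_right) (auto simp: q'_def min_absorb1 min_absorb2)
  ultimately show "\<exists>q'\<in>feasible_polygons \<alpha> \<beta> K' {0..<2 * pi}.
      ereal (polygon_length K' q') \<le> ereal (polygon_length K q)"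
    using q by (intro bexI[of _ q']) (auto simp: feasible_polygons_def q'_def)
qed

section \<open>Estimates for \<open>F\<close> and the limit of many edges\<close>

context
  fixes \<alpha> \<beta> :: real
  assumes pos: "\<alpha> > 0" "\<beta> > 0" "\<alpha> + \<beta> < pi"
begin

lemma sin_pos: "sin \<alpha> > 0" "sin \<beta> > 0" "sin (\<alpha> + \<beta>) > 0"
  using pos by (auto intro!: sin_gt_zero)

text \<open>The angle conditions make the three weights in \<open>F\<close> positive, hence
  \<open>F\<close> monotone; each weight is at most 1, hence the factor 3.\<close>

lemma F_le_add:
  assumes "\<And>\<phi>. h \<phi> \<le> h' \<phi> + \<epsilon>" "\<epsilon> \<ge> 0"
  shows "F \<alpha> \<beta> h t \<le> F \<alpha> \<beta> h' t + 3 * \<epsilon>"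
proof -
  have "F \<alpha> \<beta> h t \<le> sin \<beta> * (h' (t + pi + \<alpha>) + \<epsilon>) + sin \<alpha> * (h' (t + pi - \<beta>) + \<epsilon>)
      + sin (\<alpha> + \<beta>) * (h' t + \<epsilon>)"
    unfolding F_def using sin_pos assms by (intro add_mono mult_left_mono) auto
  also have "\<dots> = F \<alpha> \<beta> h' t + (sin \<beta> + sin \<alpha> + sin (\<alpha> + \<beta>)) * \<epsilon>"
    by (simp add: F_def algebra_simps)
  also have "(sin \<beta> + sin \<alpha> + sin (\<alpha> + \<beta>)) * \<epsilon> \<le> 3 * \<epsilon>"
    using sin_le_one[of \<alpha>] sin_le_one[of \<beta>] sin_le_one[of "\<alpha> + \<beta>"] assms(2)
    by (intro mult_right_mono) linarith+
  finally show ?thesis by simp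
qed

lemma F_mono:
  assumes "\<And>\<phi>. h \<phi> \<le> h' \<phi>"
  shows "F \<alpha> \<beta> h t \<le> F \<alpha> \<beta> h' t"
  using F_le_add[of h h' 0] assms by simp

text \<open>The three weighted directions entering \<open>F\<close> sum to zero, so the positive parts sum to half
  of the absolute values.\<close>

lemma F_segment_ge:
  "F \<alpha> \<beta> (\<lambda>\<phi>. max 0 (cos \<phi>)) t \<ge> min (sin \<beta>) (sin (\<alpha> + \<beta>)) * sin \<alpha> / 2"
proof -
  define x y where "x = cos (t + \<alpha>)" and "y = cos (t - \<beta>)"
  define m where "m = min (sin \<beta>) (sin (\<alpha> + \<beta>))"
  have m: "0 < m" "m \<le> sin \<beta>" "m \<le> sin (\<alpha> + \<beta>)" using sin_pos by (auto simp: m_def)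
  have zero: "sin \<beta> * (- x) + sin \<alpha> * (- y) + sin (\<alpha> + \<beta>) * cos t = 0"
    by (simp add: x_def y_def cos_add cos_diff sin_add algebra_simps)
  have half: "max 0 u = (u + \<bar>u\<bar>) / 2" for u :: real by auto
  have arg: "cos (t + pi + \<alpha>) = - x" "cos (t + pi - \<beta>) = - y"
    by (simp_all add: x_def y_def cos_add cos_diff sin_add sin_diff)
  have "F \<alpha> \<beta> (\<lambda>\<phi>. max 0 (cos \<phi>)) t
      = (sin \<beta> * (- x) + sin \<alpha> * (- y) + sin (\<alpha> + \<beta>) * cos t) / 2
        + (sin \<beta> * \<bar>x\<bar> + sin \<alpha> * \<bar>y\<bar> + sin (\<alpha> + \<beta>) * \<bar>cos t\<bar>) / 2"
    unfolding F_def arg half by (simp add: field_simps)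
  also have "\<dots> = (sin \<beta> * \<bar>x\<bar> + sin \<alpha> * \<bar>y\<bar> + sin (\<alpha> + \<beta>) * \<bar>cos t\<bar>) / 2"
    by (simp only: zero)
  also have "\<dots> \<ge> (m * \<bar>x\<bar> + 0 + m * \<bar>cos t\<bar>) / 2"
    using m sin_pos by (intro divide_right_mono add_mono mult_right_mono) auto
  \<comment> \<open>The cosines of \<open>t + \<alpha>\<close> and \<open>t\<close> cannot both be
    small, since the angles differ by \<alpha>, whose sine is positive. So the middle term could be
    dropped above.\<close>
  moreover have "sin \<alpha> \<le> \<bar>x\<bar> + \<bar>cos t\<bar>"
  proof -
    have "sin \<alpha> = sin ((t + \<alpha>) - t)" by simp
    also have "\<dots> = sin (t + \<alpha>) * cos t - x * sin t"
      unfolding x_def by (rule sin_diff)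
    also have "\<dots> \<le> \<bar>sin (t + \<alpha>)\<bar> * \<bar>cos t\<bar> + \<bar>x\<bar> * \<bar>sin t\<bar>"
      unfolding abs_mult[symmetric] by linarith
    also have "\<dots> \<le> 1 * \<bar>cos t\<bar> + \<bar>x\<bar> * 1"
      by (intro add_mono mult_mono) auto
    finally show ?thesis by simp
  qed
  then have "m * sin \<alpha> \<le> m * (\<bar>x\<bar> + \<bar>cos t\<bar>)" using m by (intro mult_left_mono) auto
  ultimately show ?thesis by (simp add: m_def[symmetric] algebra_simps)
qed

text \<open>The unit segment has support function \<open>max 0 (cos \<phi>)\<close>, for which
  \<open>F\<close> is bounded below by a positive constant, so a multiple of it is feasible.\<close>

lemma opt_polygon_1_finite: "opt_polygon \<alpha> \<beta> 1 < \<infinity>"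
proof -
  define q :: "nat \<Rightarrow> real ^ 2" where "q i = (if i = 0 then 0 else direction 0)" for i
  define c where "c = sin \<alpha> * sin \<beta>"
  define e where "e = min (sin \<beta>) (sin (\<alpha> + \<beta>)) * sin \<alpha> / 2"
  have ce: "c > 0" "e > 0" using sin_pos by (auto simp: c_def e_def)
  have "polygon_support 1 q = (\<lambda>\<phi>. max 0 (cos \<phi>))"
    by (auto simp: polygon_support_def q_def direction_def inner_vec_def UNIV_2 numeral_2_eq_2
        atLeast0_atMost_Suc max.commute)
  \<comment> \<open>The deficit \<open>1 - e / c\<close> is chosen so that the required bound
    becomes \<open>e\<close>; the segment is then scaled by \<open>c / e\<close>.\<close>
  then have "F \<alpha> \<beta> (polygon_support 1 q) t \<ge> (1 - (1 - e / c)) * (sin \<alpha> * sin \<beta>)" for t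
    using F_segment_ge[of t] ce by (simp add: e_def[symmetric] c_def[symmetric])
  then have "opt_polygon \<alpha> \<beta> 1 \<le> ereal (polygon_length 1 q / (1 - (1 - e / c)))"
    using ce by (intro opt_polygon_le_rescaled) (auto simp: q_def)
  then show ?thesis by (rule le_less_trans) simp
qed

lemma opt_path_le_opt_polygon:
  assumes "K > 0"
  shows "opt_path \<alpha> \<beta> \<le> opt_polygon \<alpha> \<beta> K"
  unfolding opt_polygon_def
proof (rule INF_greatest)
  fix q assume q: "q \<in> feasible_polygons \<alpha> \<beta> K {0..<2 * pi}"
  let ?\<gamma> = "polygon_path K q"
  have "?\<gamma> 0 = 0" using polygon_path_vertex[of 0 K q] assms q by (simp add: feasible_polygons_def)
  moreover have "path_length ?\<gamma> < \<infinity>"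
    by (rule order.strict_trans1[OF path_length_polygon_path]) simp
  moreover have "F \<alpha> \<beta> (path_support ?\<gamma>) t \<ge> sin \<alpha> * sin \<beta>" if "t \<in> {0..<2 * pi}" for t
    using q that F_mono[of "polygon_support K q" "path_support ?\<gamma>" t,
        OF polygon_support_le_path_support[OF assms]]
    unfolding feasible_polygons_def by fastforce
  ultimately have "?\<gamma> \<in> feasible_paths \<alpha> \<beta>"
    by (simp add: feasible_paths_def path_polygon_path)
  then have "opt_path \<alpha> \<beta> \<le> path_length ?\<gamma>" unfolding opt_path_def by (rule INF_lower)
  also have "\<dots> \<le> ereal (polygon_length K q)" by (rule path_length_polygon_path)
  finally show "opt_path \<alpha> \<beta> \<le> ereal (polygon_length K q)" .
qed

lemma eventually_opt_polygon_le:
  assumes \<gamma>: "\<gamma> \<in> feasible_paths \<alpha> \<beta>" "path_length \<gamma> = ereal L" and \<delta>: "0 < \<delta>" "\<delta> < 1"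
  shows "eventually (\<lambda>K. opt_polygon \<alpha> \<beta> K \<le> ereal (L / (1 - \<delta>))) sequentially"
proof -
  define c where "c = sin \<alpha> * sin \<beta>"
  \<comment> \<open>The factor 3 of \<open>F_le_add\<close> turns this into a total loss of
    \<open>\<delta> * c\<close>.\<close>
  define \<epsilon> where "\<epsilon> = \<delta> * c / 3"
  have c: "c > 0" and \<epsilon>: "\<epsilon> > 0" using sin_pos \<delta> by (auto simp: c_def \<epsilon>_def)
  have path: "path \<gamma>" using \<gamma> by (simp add: feasible_paths_def)
  then have "uniformly_continuous_on {0..1} \<gamma>"
    unfolding path_def by (intro compact_uniformly_continuous) auto
  then obtain d where d: "d > 0"
    and uc: "\<And>p p'. p \<in> {0..1} \<Longrightarrow> p' \<in> {0..1} \<Longrightarrow> dist p p' < d \<Longrightarrow> dist (\<gamma> p) (\<gamma> p') < \<epsilon>"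
    unfolding uniformly_continuous_on_def using \<epsilon> by (metis dist_commute)
  have "eventually (\<lambda>K. 1 / real K < d) sequentially"
    using d by (rule order_tendstoD(2)[OF lim_1_over_n])
  then show ?thesis
    using eventually_gt_at_top[of 0]
  proof eventually_elim
    case (elim K)
    let ?q = "sampled_polygon K \<gamma>"
    have near: "path_support \<gamma> \<phi> \<le> polygon_support K ?q \<phi> + \<epsilon>" for \<phi>
      using elim uc by (intro path_support_le_sampled) (auto simp: dist_real_def less_imp_le)
    have "(1 - \<delta>) * (sin \<alpha> * sin \<beta>) \<le> F \<alpha> \<beta> (polygon_support K ?q) t" if "t \<in> {0..<2 * pi}" for t
    proof -
      have "c \<le> F \<alpha> \<beta> (path_support \<gamma>) t"
        using \<gamma> that by (auto simp: feasible_paths_def c_def)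
      also have "\<dots> \<le> F \<alpha> \<beta> (polygon_support K ?q) t + 3 * \<epsilon>"
        using near \<epsilon> by (intro F_le_add) auto
      finally show ?thesis by (simp add: \<epsilon>_def c_def[symmetric] algebra_simps)
    qed
    then have "opt_polygon \<alpha> \<beta> K \<le> ereal (polygon_length K ?q / (1 - \<delta>))"
      using \<gamma> \<delta> by (intro opt_polygon_le_rescaled) (auto simp: sampled_polygon_def feasible_paths_def)
    also have "\<dots> \<le> ereal (L / (1 - \<delta>))"
      using polygon_length_sampled[of K \<gamma>] elim \<gamma> \<delta> by (auto intro!: divide_right_mono)
    finally show ?case .
  qed
qed

lemma opt_polygon_tendsto_opt_path: "opt_polygon \<alpha> \<beta> \<longlonglongrightarrow> opt_path \<alpha> \<beta>"
proof (rule order_tendstoI)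
  fix a assume "a < opt_path \<alpha> \<beta>"
  then show "eventually (\<lambda>K. a < opt_polygon \<alpha> \<beta> K) sequentially"
    by (intro eventually_mono[OF eventually_gt_at_top[of 0]])
      (rule less_le_trans[OF _ opt_path_le_opt_polygon])
next
  fix a assume "opt_path \<alpha> \<beta> < a"
  then obtain \<gamma> where \<gamma>: "\<gamma> \<in> feasible_paths \<alpha> \<beta>" "path_length \<gamma> < a"
    unfolding opt_path_def by (auto simp: INF_less_iff)
  then obtain L where L: "path_length \<gamma> = ereal L" "L \<ge> 0"
    using path_length_nonneg[of \<gamma>] by (cases "path_length \<gamma>") (auto simp: feasible_paths_def)
  obtain b where b: "L < b" "ereal b < a"
    using ereal_dense2[of "ereal L" a] \<gamma> L by auto
  \<comment> \<open>Here \<open>1 - \<delta>\<close> is the mean of 1 and \<open>L / b\<close>, so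
    it is at least \<open>L / b\<close>. Taking the mean keeps it positive when
    \<open>L = 0\<close>.\<close>
  define \<delta> where "\<delta> = (1 - L / b) / 2"
  have \<delta>: "0 < \<delta>" "\<delta> < 1" using L b by (auto simp: \<delta>_def field_simps)
  have "L / (1 - \<delta>) \<le> b"
    using L b by (simp add: \<delta>_def field_simps)
  then have "ereal (L / (1 - \<delta>)) < a"
    by (intro le_less_trans[OF _ b(2)]) simp
  then show "eventually (\<lambda>K. opt_polygon \<alpha> \<beta> K < a) sequentially"
    by (intro eventually_mono[OF eventually_opt_polygon_le[OF \<gamma>(1) L(1) \<delta>]])
      (rule le_less_trans)
qed

section \<open>Sampling the constraint at finitely many angles\<close>

text \<open>A single \<open>D\<close> serves all \<open>K\<close> and \<open>M\<close>; this
  uniformity permits the joint limit.\<close>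

lemma opt_polygon_le_discrete:
  obtains D where "D \<ge> 0"
    "\<And>K M. K > 0 \<Longrightarrow> real M > D \<Longrightarrow>
      ereal (1 - D / M) * opt_polygon \<alpha> \<beta> K \<le> opt_polygon_discrete \<alpha> \<beta> K M"
proof -
  obtain R where R: "opt_polygon \<alpha> \<beta> 1 = ereal R" "R \<ge> 0"
    using opt_polygon_1_finite opt_polygon_nonneg[of \<alpha> \<beta> 1] by (cases "opt_polygon \<alpha> \<beta> 1") auto
  define c where "c = sin \<alpha> * sin \<beta>"
  \<comment> \<open>The loss is at most 3 (from \<open>F_le_add\<close>) times the Lipschitz
    constant \<open>2 * R\<close> times the mesh width \<open>2 * pi / M\<close>; this equals
    \<open>D / M * c\<close>.\<close>
  define D where "D = 12 * pi * R / c"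
  have c: "c > 0" and D: "D \<ge> 0" using sin_pos R by (auto simp: c_def D_def)
  have "ereal (1 - D / M) * opt_polygon \<alpha> \<beta> K \<le> opt_polygon_discrete \<alpha> \<beta> K M"
    if K: "K > 0" and M: "real M > D" for K M :: nat
    unfolding opt_polygon_discrete_def
  proof (rule INF_greatest)
    fix q assume q: "q \<in> feasible_polygons \<alpha> \<beta> K ((\<lambda>j. 2 * pi * real j / real M) ` {..<M})"
    let ?l = "polygon_length K q"
    define \<delta> where "\<delta> = D / M"
    have M0: "M > 0" using M D by (cases M) auto
    have \<delta>: "0 \<le> \<delta>" "\<delta> < 1" using D M by (auto simp: \<delta>_def)
    have q0: "q 0 = 0" using q by (simp add: feasible_polygons_def)
    have "opt_polygon \<alpha> \<beta> K \<le> ereal (?l / (1 - \<delta>))"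
    \<comment> \<open>Polygons of length at most \<open>R\<close> have a uniform Lipschitz constant
      and can be rescaled. Longer ones already exceed the one-edge optimum, which bounds
      \<open>opt_polygon \<alpha> \<beta> K\<close> from above.\<close>
    proof (cases "?l \<le> R")
      case True
      have "(1 - \<delta>) * (sin \<alpha> * sin \<beta>) \<le> F \<alpha> \<beta> (polygon_support K q) t"
        if t: "t \<in> {0..<2 * pi}" for t
      proof -
        \<comment> \<open>The nearest sample at or before \<open>t\<close>;
          \<open>t < 2 * pi\<close> ensures \<open>j < M\<close>.\<close>
        define j where "j = nat \<lfloor>M * t / (2 * pi)\<rfloor>"
        define s where "s = 2 * pi * real j / M"
        have "0 \<le> M * t / (2 * pi)" "M * t / (2 * pi) < M"
          using t M0 by (auto simp: field_simps)
        then have j: "j < M" "real j \<le> M * t / (2 * pi)" "M * t / (2 * pi) \<le> j + 1"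
          unfolding j_def by linarith+
        have "s - t = 2 * pi / M * (j - M * t / (2 * pi))"
          using M0 by (simp add: s_def field_simps)
        also have "\<bar>\<dots>\<bar> \<le> 2 * pi / M * 1"
          using j unfolding abs_mult by (intro mult_mono) auto
        finally have st: "\<bar>s - t\<bar> \<le> 2 * pi / M" by simp
        have lip: "polygon_support K q (\<phi> + (s - t)) \<le> polygon_support K q \<phi> + 2 * R * (2 * pi / M)"
          for \<phi>
        proof -
          have "norm (q i) \<le> R" if "i \<le> K" for i
            using norm_vertex_le_polygon_length[of q i K] q0 that True by simp
          then have "polygon_support K q (\<phi> + (s - t))
              \<le> polygon_support K q \<phi> + 2 * R * \<bar>\<phi> + (s - t) - \<phi>\<bar>"
            by (rule polygon_support_lipschitz)
          also have "\<dots> \<le> polygon_support K q \<phi> + 2 * R * (2 * pi / M)"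
            using st R by (intro add_left_mono mult_left_mono) auto
          finally show ?thesis .
        qed
        have "c \<le> F \<alpha> \<beta> (polygon_support K q) s"
          using q j by (auto simp: feasible_polygons_def s_def c_def)
        \<comment> \<open>Moving the shift from the angle into the support function leaves two
          functions to compare at the same \<open>t\<close>.\<close>
        also have "\<dots> = F \<alpha> \<beta> (\<lambda>\<phi>. polygon_support K q (\<phi> + (s - t))) t"
          by (simp add: F_def algebra_simps)
        also have "\<dots> \<le> F \<alpha> \<beta> (polygon_support K q) t + 3 * (2 * R * (2 * pi / M))"
          using lip R by (intro F_le_add) auto
        also have "3 * (2 * R * (2 * pi / M)) = \<delta> * c"
          using c by (simp add: \<delta>_def D_def)
        finally show ?thesis by (simp add: c_def[symmetric] algebra_simps)
      qed
      then show ?thesis using q0 \<delta> by (intro opt_polygon_le_rescaled)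
    next
      case False
      have "opt_polygon \<alpha> \<beta> K \<le> opt_polygon \<alpha> \<beta> 1"
        using K by (intro opt_polygon_antimono) auto
      also have "\<dots> \<le> ereal (?l / 1)" using R False by simp
      also have "\<dots> \<le> ereal (?l / (1 - \<delta>))"
        unfolding ereal_less_eq using \<delta> by (intro divide_left_mono) auto
      finally show ?thesis .
    qed
    then have "ereal (1 - \<delta>) * opt_polygon \<alpha> \<beta> K \<le> ereal (1 - \<delta>) * ereal (?l / (1 - \<delta>))"
      using \<delta> by (intro ereal_mult_left_mono) auto
    also have "\<dots> = ereal ?l" using \<delta> by simp
    finally show "ereal (1 - D / M) * opt_polygon \<alpha> \<beta> K \<le> ereal ?l" by (simp add: \<delta>_def)
  qed
  with D show thesis by (rule that)
qed

text \<open>The sampled value is squeezed between \<open>1 - D / Mn n\<close> times the polygonal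
  value and that value itself. Constant \<open>Kn\<close> gives the first claim of the theorem,
  divergent \<open>Kn\<close> the second.\<close>

lemma opt_polygon_discrete_tendsto:
  assumes Mn: "filterlim Mn at_top sequentially" and Kn: "eventually (\<lambda>n. Kn n > 0) sequentially"
    and v: "(\<lambda>n. opt_polygon \<alpha> \<beta> (Kn n)) \<longlonglongrightarrow> v"
  shows "(\<lambda>n. opt_polygon_discrete \<alpha> \<beta> (Kn n) (Mn n)) \<longlonglongrightarrow> v"
proof -
  obtain D where D: "D \<ge> 0" "\<And>K M. K > 0 \<Longrightarrow> real M > D \<Longrightarrow>
      ereal (1 - D / M) * opt_polygon \<alpha> \<beta> K \<le> opt_polygon_discrete \<alpha> \<beta> K M"
    using opt_polygon_le_discrete by blast
  have M: "filterlim (\<lambda>n. real (Mn n)) at_top sequentially"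
    using filterlim_compose[OF filterlim_real_sequentially Mn] .
  have "(\<lambda>n. 1 - D / real (Mn n)) \<longlonglongrightarrow> 1 - 0"
    by (intro tendsto_diff tendsto_const real_tendsto_divide_at_top[OF tendsto_const M])
  then have "(\<lambda>n. ereal (1 - D / Mn n)) \<longlonglongrightarrow> ereal 1" by simp
  \<comment> \<open>The factor tends to 1, so the extended real product has no indeterminate form,
    whatever \<open>v\<close> is.\<close>
  then have lower: "(\<lambda>n. ereal (1 - D / Mn n) * opt_polygon \<alpha> \<beta> (Kn n)) \<longlonglongrightarrow> ereal 1 * v"
    using v by (intro tendsto_mult_ereal) auto
  have "eventually (\<lambda>n. ereal (1 - D / Mn n) * opt_polygon \<alpha> \<beta> (Kn n)
      \<le> opt_polygon_discrete \<alpha> \<beta> (Kn n) (Mn n)) sequentially"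
    using Kn M[unfolded filterlim_at_top_dense, rule_format, of D]
    by eventually_elim (rule D(2))
  moreover have "eventually (\<lambda>n. opt_polygon_discrete \<alpha> \<beta> (Kn n) (Mn n)
      \<le> opt_polygon \<alpha> \<beta> (Kn n)) sequentially"
    by (simp add: opt_polygon_discrete_le_opt_polygon)
  ultimately show ?thesis
    by (rule tendsto_sandwich) (use lower v in \<open>simp_all flip: one_ereal_def\<close>)
qed

end

theorem theorem8:
  fixes \<alpha> \<beta> :: real
  assumes "\<alpha> > 0" and "\<beta> > 0" and "\<alpha> + \<beta> < pi"
  shows "(\<forall>K\<ge>1. (\<lambda>M. opt_polygon_discrete \<alpha> \<beta> K M) \<longlonglongrightarrow> opt_polygon \<alpha> \<beta> K) \<and>
    (\<forall>Kn Mn :: nat \<Rightarrow> nat.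
       (\<forall>n. Kn n \<ge> 1 \<and> Mn n \<ge> 1) \<longrightarrow>
       filterlim Kn at_top sequentially \<longrightarrow>
       filterlim Mn at_top sequentially \<longrightarrow>
       (\<lambda>n. opt_polygon_discrete \<alpha> \<beta> (Kn n) (Mn n)) \<longlonglongrightarrow> opt_path \<alpha> \<beta>)"
proof (intro conjI allI impI)
  fix K :: nat assume "1 \<le> K"
  then show "(\<lambda>M. opt_polygon_discrete \<alpha> \<beta> K M) \<longlonglongrightarrow> opt_polygon \<alpha> \<beta> K"
    using opt_polygon_discrete_tendsto[OF assms, of "\<lambda>M. M" "\<lambda>_. K"]
    by (simp add: filterlim_ident)
next
  fix Kn Mn :: "nat \<Rightarrow> nat"
  assume pos: "\<forall>n. Kn n \<ge> 1 \<and> Mn n \<ge> 1"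
    and Kn: "filterlim Kn at_top sequentially" and Mn: "filterlim Mn at_top sequentially"
  have "eventually (\<lambda>n. Kn n > 0) sequentially"
    using pos by (auto simp: Suc_le_eq)
  then show "(\<lambda>n. opt_polygon_discrete \<alpha> \<beta> (Kn n) (Mn n)) \<longlonglongrightarrow> opt_path \<alpha> \<beta>"
    using filterlim_compose[OF opt_polygon_tendsto_opt_path[OF assms] Kn]
    by (rule opt_polygon_discrete_tendsto[OF assms Mn])
qed

end
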